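(* Let $(X,\|\cdot\|)$ be a finite dimensional real normed linear space and let $(G,p)$, $G=(V,E)$, be a well-positioned bar-joint framework in $(X,\|\cdot\|)$ which is $\mathbb{Z}_2$-symmetric with respect to an action $\theta:\mathbb{Z}_2\to\mathrm{Aut}(G)$ and a representation $\tau:\mathbb{Z}_2\to\mathrm{Isom}(X,\|\cdot\|)$. (i) $X^{|V|}$ may be expressed as a direct sum $X^{|V|}=X_1\oplus X_2$ where $$X_1=\{(x_v)_{v\in V}\in X^{|V|}: x_{-v}=\tau(-1)x_v\ \ \forall v\in V\},\qquad X_2=\{(x_v)_{v\in V}\in X^{|V|}: x_{-v}=-\tau(-1)x_v\ \ \forall v\in V\}.$$ (ii) $\mathbb{R}^{|E|}$ may be expressed as a direct sum $\mathbb{R}^{|E|}=Y_1\oplus Y_2$ where $$Y_1=\{(y_e)_{e\in E}\in\mathbb{R}^{|E|}: y_{-e}=y_e\ \ \forall e\in E\},\qquad Y_2=\{(y_e)_{e\in E}\in\mathbb{R}^{|E|}: y_{-e}=-y_e\ \ \forall e\in E\}.$$ (iii) With respect to the direct sum decompositions $X^{|V|}=X_1\oplus X_2$ and $\mathbb{R}^{|E|}=Y_1\oplus Y_2$, the differential $df_G(p)$ may be expressed as a direct sum of linear transformations $df_G(p)=R_1\oplus R_2$, where $R_1:X_1\to Y_1$ and $R_2:X_2\to Y_2$.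
   Context: $G=(V,E)$ is a finite simple undirected graph; $\mathbb{Z}_2=\{1,-1\}$ (multiplicative). The action $\theta:\mathbb{Z}_2\to\mathrm{Aut}(G)$ is a group homomorphism, assumed throughout to be free on $V$; write $-v=\theta(-1)v$ (so $v\ne-v$) and $-e=(-v)(-w)$ for $e=vw\in E$; edges with $e=-e$ are allowed. A bar-joint framework is a pair $(G,p)$ with $p=(p_v)_{v\in V}\in X^{|V|}$ and $p_v\ne p_w$ for all $vw\in E$. The rigidity map is $f_G:X^{|V|}\to\mathbb{R}^{|E|}$, $f_G(x)=(\|x_v-x_w\|)_{vw\in E}$; $(G,p)$ is well-positioned if $f_G$ is differentiable at $p$, and $df_G(p)$ denotes the differential. $\mathrm{Isom}(X,\|\cdot\|)$ is the group of linear isometries of $X$. $(G,p)$ is $\mathbb{Z}_2$-symmetric with respect to $\theta$ and the representation $\tau$ if $\tau(-1)p_v=p_{-v}$ for all $v\in V$. *)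

theory Defs
  imports "HOL-Analysis.Analysis" "HOL-Algebra.Group"
begin

text \<open>
  The vertex set is the universe of a finite type \<open>'v\<close>; an undirected edge is the set of
  its two endpoints, and a graph is given by its edge set.
\<close>

definition simple_graph :: "'v::finite set set \<Rightarrow> bool" where
  "simple_graph E \<longleftrightarrow> (\<forall>e\<in>E. card e = 2)"

definition Z2 :: "int monoid" where
  "Z2 = \<lparr>carrier = {1, -1}, monoid.mult = (*), one = 1\<rparr>"

definition Aut :: "'v::finite set set \<Rightarrow> ('v \<Rightarrow> 'v) monoid" where
  "Aut E = \<lparr>carrier = {\<pi>. bij \<pi> \<and> (\<forall>v w. {v, w} \<in> E \<longleftrightarrow> {\<pi> v, \<pi> w} \<in> E)},
            monoid.mult = (\<circ>), one = id\<rparr>"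

definition Isom :: "('x::real_normed_vector \<Rightarrow> 'x) monoid" where
  "Isom = \<lparr>carrier = {T. linear T \<and> bij T \<and> (\<forall>x. norm (T x) = norm x)},
           monoid.mult = (\<circ>), one = id\<rparr>"

definition free_action :: "(int \<Rightarrow> 'v \<Rightarrow> 'v) \<Rightarrow> bool" where
  "free_action \<theta> \<longleftrightarrow> (\<forall>g\<in>carrier Z2. \<forall>v. \<theta> g v = v \<longrightarrow> g = \<one>\<^bsub>Z2\<^esub>)"

abbreviation neg_edge :: "(int \<Rightarrow> 'v \<Rightarrow> 'v) \<Rightarrow> 'v set \<Rightarrow> 'v set" where
  "neg_edge \<theta> e \<equiv> \<theta> (-1) ` e"

lemma group_Z2: "group Z2"
  by (rule groupI) (auto simp: Z2_def)

lemma group_Aut: "group (Aut E)"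
proof (rule groupI)
  fix \<pi> assume \<pi>: "\<pi> \<in> carrier (Aut E)"
  then have "bij \<pi>" by (simp add: Aut_def)
  have "{v, w} \<in> E \<longleftrightarrow> {Hilbert_Choice.inv \<pi> v, Hilbert_Choice.inv \<pi> w} \<in> E" for v w
  proof -
    have "\<pi> (Hilbert_Choice.inv \<pi> u) = u" for u
      using \<open>bij \<pi>\<close> by (simp add: bij_is_surj surj_f_inv_f)
    moreover have "{\<pi> a, \<pi> b} \<in> E \<longleftrightarrow> {a, b} \<in> E" for a b
      using \<pi> by (simp add: Aut_def)
    ultimately show ?thesis by metis
  qed
  then have "Hilbert_Choice.inv \<pi> \<in> carrier (Aut E)"
    using \<open>bij \<pi>\<close> by (simp add: Aut_def bij_imp_bij_inv)
  moreover have "Hilbert_Choice.inv \<pi> \<otimes>\<^bsub>Aut E\<^esub> \<pi> = \<one>\<^bsub>Aut E\<^esub>"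
    using \<open>bij \<pi>\<close> by (simp add: Aut_def bij_is_inj)
  ultimately show "\<exists>\<rho>\<in>carrier (Aut E). \<rho> \<otimes>\<^bsub>Aut E\<^esub> \<pi> = \<one>\<^bsub>Aut E\<^esub>" by blast
qed (auto simp: Aut_def bij_comp comp_assoc)

lemma group_Isom: "group (Isom :: ('x::real_normed_vector \<Rightarrow> 'x) monoid)"
proof (rule groupI)
  fix T :: "'x \<Rightarrow> 'x" assume T: "T \<in> carrier Isom"
  then have "linear T" "bij T" and nT: "\<And>x. norm (T x) = norm x" by (auto simp: Isom_def)
  have TI: "T (Hilbert_Choice.inv T x) = x" for x
    using \<open>bij T\<close> by (simp add: bij_is_surj surj_f_inv_f)
  have "inj T" using \<open>bij T\<close> by (rule bij_is_inj)
  have "linear (Hilbert_Choice.inv T)"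
  proof (rule linearI)
    fix x y
    have "T (Hilbert_Choice.inv T (x + y)) = T (Hilbert_Choice.inv T x + Hilbert_Choice.inv T y)"
      by (simp add: TI linear_add[OF \<open>linear T\<close>])
    then show "Hilbert_Choice.inv T (x + y) = Hilbert_Choice.inv T x + Hilbert_Choice.inv T y"
      by (rule injD[OF \<open>inj T\<close>])
  next
    fix c x
    have "T (Hilbert_Choice.inv T (c *\<^sub>R x)) = T (c *\<^sub>R Hilbert_Choice.inv T x)"
      by (simp add: TI linear_scale[OF \<open>linear T\<close>])
    then show "Hilbert_Choice.inv T (c *\<^sub>R x) = c *\<^sub>R Hilbert_Choice.inv T x"
      by (rule injD[OF \<open>inj T\<close>])
  qed
  moreover have "norm (Hilbert_Choice.inv T x) = norm x" for x
    using nT[of "Hilbert_Choice.inv T x"] by (simp only: TI)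
  ultimately have "Hilbert_Choice.inv T \<in> carrier Isom"
    using \<open>bij T\<close> by (simp add: Isom_def bij_imp_bij_inv)
  moreover have "Hilbert_Choice.inv T \<otimes>\<^bsub>Isom\<^esub> T = \<one>\<^bsub>Isom\<^esub>"
    using \<open>bij T\<close> by (simp add: Isom_def bij_is_inj)
  ultimately show "\<exists>S\<in>carrier Isom. S \<otimes>\<^bsub>Isom\<^esub> T = \<one>\<^bsub>Isom\<^esub>" by blast
qed (auto simp: Isom_def bij_comp comp_assoc linear_compose linear_id)

definition bar_joint_framework :: "'v::finite set set \<Rightarrow> 'x ^ 'v \<Rightarrow> bool" where
  "bar_joint_framework E p \<longleftrightarrow> simple_graph E \<and> (\<forall>v w. {v, w} \<in> E \<longrightarrow> p $ v \<noteq> p $ w)"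

text \<open>
  The description below is independent of the order of the endpoints because the norm is even;
  see \<open>edge_length_pair\<close>.
\<close>

definition edge_length :: "'x::real_normed_vector ^ 'v \<Rightarrow> 'v::finite set \<Rightarrow> real" where
  "edge_length x e = (THE d. \<exists>v w. e = {v, w} \<and> d = norm (x $ v - x $ w))"

lemma edge_length_pair: "edge_length x {v, w} = norm (x $ v - x $ w)"
  unfolding edge_length_def
  by (rule the_equality) (auto simp: doubleton_eq_iff norm_minus_commute)

text \<open>
  The space of real vectors indexed by \<open>E\<close>, realised as the vectors indexed by all vertex
  sets which vanish outside \<open>E\<close>.
\<close>

definition edge_space :: "'v::finite set set \<Rightarrow> (real ^ 'v set) set" where
  "edge_space E = {y. \<forall>e. e \<notin> E \<longrightarrow> y $ e = 0}"

definition rigidity_map ::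
  "'v::finite set set \<Rightarrow> 'x::real_normed_vector ^ 'v \<Rightarrow> real ^ 'v set" where
  "rigidity_map E x = (\<chi> e. if e \<in> E then edge_length x e else 0)"

lemma rigidity_map_in_edge_space: "rigidity_map E x \<in> edge_space E"
  by (simp add: rigidity_map_def edge_space_def)

definition well_positioned ::
  "'v::finite set set \<Rightarrow> 'x::real_normed_vector ^ 'v \<Rightarrow> bool" where
  "well_positioned E p \<longleftrightarrow> rigidity_map E differentiable (at p)"

definition rigidity_differential ::
  "'v::finite set set \<Rightarrow> 'x::real_normed_vector ^ 'v \<Rightarrow> 'x ^ 'v \<Rightarrow> real ^ 'v set" where
  "rigidity_differential E p = frechet_derivative (rigidity_map E) (at p)"

definition Z2_symmetric ::
  "(int \<Rightarrow> 'v::finite \<Rightarrow> 'v) \<Rightarrow> (int \<Rightarrow> 'x \<Rightarrow> 'x) \<Rightarrow> 'x ^ 'v \<Rightarrow> bool" where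
  "Z2_symmetric \<theta> \<tau> p \<longleftrightarrow> (\<forall>v. \<tau> (-1) (p $ v) = p $ \<theta> (-1) v)"

definition X1 :: "(int \<Rightarrow> 'v::finite \<Rightarrow> 'v) \<Rightarrow> (int \<Rightarrow> 'x \<Rightarrow> 'x) \<Rightarrow> ('x::real_normed_vector ^ 'v) set"
  where "X1 \<theta> \<tau> = {x. \<forall>v. x $ \<theta> (-1) v = \<tau> (-1) (x $ v)}"

definition X2 :: "(int \<Rightarrow> 'v::finite \<Rightarrow> 'v) \<Rightarrow> (int \<Rightarrow> 'x \<Rightarrow> 'x) \<Rightarrow> ('x::real_normed_vector ^ 'v) set"
  where "X2 \<theta> \<tau> = {x. \<forall>v. x $ \<theta> (-1) v = - \<tau> (-1) (x $ v)}"

definition Y1 :: "'v::finite set set \<Rightarrow> (int \<Rightarrow> 'v \<Rightarrow> 'v) \<Rightarrow> (real ^ 'v set) set"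
  where "Y1 E \<theta> = {y \<in> edge_space E. \<forall>e\<in>E. y $ neg_edge \<theta> e = y $ e}"

definition Y2 :: "'v::finite set set \<Rightarrow> (int \<Rightarrow> 'v \<Rightarrow> 'v) \<Rightarrow> (real ^ 'v set) set"
  where "Y2 E \<theta> = {y \<in> edge_space E. \<forall>e\<in>E. y $ neg_edge \<theta> e = - y $ e}"

definition is_direct_sum :: "'a::real_vector set \<Rightarrow> 'a set \<Rightarrow> 'a set \<Rightarrow> bool" where
  "is_direct_sum W A B \<longleftrightarrow>
     subspace W \<and> subspace A \<and> subspace B \<and> W = {a + b | a b. a \<in> A \<and> b \<in> B} \<and> A \<inter> B = {0}"

text \<open>The values of \<open>f\<close> outside \<open>A\<close> are irrelevant.\<close>

definition linear_between ::
  "'a::real_vector set \<Rightarrow> 'b::real_vector set \<Rightarrow> ('a \<Rightarrow> 'b) \<Rightarrow> bool" where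
  "linear_between A B f \<longleftrightarrow>
     f ` A \<subseteq> B \<and> (\<forall>x\<in>A. \<forall>y\<in>A. f (x + y) = f x + f y) \<and>
     (\<forall>c. \<forall>x\<in>A. f (c *\<^sub>R x) = c *\<^sub>R f x)"

text \<open>\<open>D = R \<oplus> S\<close> for maps \<open>R\<close> on \<open>A\<close> and \<open>S\<close> on \<open>B\<close>, where the domain of \<open>D\<close> is \<open>A \<oplus> B\<close>.\<close>

definition is_direct_sum_map ::
  "'a::real_vector set \<Rightarrow> 'a set \<Rightarrow> ('a \<Rightarrow> 'b::real_vector) \<Rightarrow> ('a \<Rightarrow> 'b) \<Rightarrow> ('a \<Rightarrow> 'b) \<Rightarrow> bool"
  where "is_direct_sum_map A B D R S \<longleftrightarrow> (\<forall>a\<in>A. \<forall>b\<in>B. D (a + b) = R a + S b)"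

end

theory Submission
  imports Defs
begin

text \<open>
  Both decompositions are eigenspace decompositions of linear involutions. On
  \<open>X\<^sup>V\<close> the involution \<open>S\<close> is \<open>(S x)\<^sub>v = \<tau>(-1) x\<^bsub>-v\<^esub>\<close>, and \<open>X\<^sub>1\<close>, \<open>X\<^sub>2\<close> are its eigenspaces for
  \<open>1\<close> and \<open>-1\<close>; on \<open>\<real>\<^sup>E\<close> the involution \<open>P\<close> is \<open>(P y)\<^sub>e = y\<^bsub>-e\<^esub>\<close>, with eigenspaces \<open>Y\<^sub>1\<close> and \<open>Y\<^sub>2\<close>.
  Writing \<open>x = (x + S x)/2 + (x - S x)/2\<close> proves (i) and (ii).

  For (iii), \<open>\<tau>(-1)\<close> preserves the norm, so the rigidity map \<open>f\<close> is equivariant: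
  \<open>f \<circ> S = P \<circ> f\<close>. Symmetry of the framework says \<open>S p = p\<close>, so
  differentiating this identity at \<open>p\<close> by the chain rule gives \<open>df(p) \<circ> S = P \<circ> df(p)\<close>
  (\<open>derivative_at_fixed_point_intertwines\<close>). Hence \<open>df(p)\<close> maps each eigenspace of \<open>S\<close> to the
  eigenspace of \<open>P\<close> for the same eigenvalue, and \<open>R\<^sub>1\<close>, \<open>R\<^sub>2\<close> are its restrictions.
\<close>

text \<open>
  The projections onto the two summands are \<open>x \<mapsto> (x + S x)/2\<close> and \<open>x \<mapsto> (x - S x)/2\<close>.
  The subspace \<open>W\<close> is there because the real vectors indexed by the edges form only a subspace of their ambient type.
\<close>

lemma involution_eigenspaces_direct_sum:
  fixes S :: "'a::real_vector \<Rightarrow> 'a"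
  assumes "linear S" and W: "subspace W"
    and closed: "\<And>x. x \<in> W \<Longrightarrow> S x \<in> W" and inv: "\<And>x. x \<in> W \<Longrightarrow> S (S x) = x"
  shows "is_direct_sum W {x \<in> W. S x = x} {x \<in> W. S x = - x}"
proof -
  interpret linear S by fact
  let ?A = "{x \<in> W. S x = x}" and ?B = "{x \<in> W. S x = - x}"
  have "subspace ?A" "subspace ?B"
    using W by (auto simp: subspace_def add scale zero)
  moreover have "W = {a + b | a b. a \<in> ?A \<and> b \<in> ?B}"
  proof (intro equalityI subsetI)
    fix x assume x: "x \<in> W"
    let ?a = "(1/2) *\<^sub>R (x + S x)" and ?b = "(1/2) *\<^sub>R (x - S x)"
    have "?a \<in> ?A" "?b \<in> ?B"
      using x W closed[OF x] inv[OF x]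
      by (auto simp: add diff scale subspace_add subspace_diff subspace_scale algebra_simps)
    moreover have "x = ?a + ?b"
      by (simp add: scaleR_add_right[symmetric] flip: scaleR_2)
    ultimately show "x \<in> {a + b | a b. a \<in> ?A \<and> b \<in> ?B}" by blast
  qed (use W in \<open>auto intro: subspace_add\<close>)
  moreover have "x = 0" if "x = - x" for x :: 'a
    using that scaleR_2[of x] by (simp add: eq_neg_iff_add_eq_0)
  then have "?A \<inter> ?B = {0}"
    using W by (auto simp: zero subspace_0)
  ultimately show ?thesis
    using W unfolding is_direct_sum_def by blast
qed

text \<open>
  Since \<open>S p = p\<close>, the chain rule for \<open>f \<circ> S\<close> at \<open>p\<close> again evaluates the derivative of \<open>f\<close> at \<open>p\<close>;
  uniqueness of the derivative then equates it with the derivative of \<open>P \<circ> f\<close>.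
\<close>

lemma derivative_at_fixed_point_intertwines:
  fixes f :: "'a::real_normed_vector \<Rightarrow> 'b::real_normed_vector"
  assumes "f differentiable (at p)" and "bounded_linear S" and "bounded_linear P"
    and equivariant: "\<And>x. f (S x) = P (f x)" and fixed: "S p = p"
  shows "frechet_derivative f (at p) (S x) = P (frechet_derivative f (at p) x)"
proof -
  let ?D = "frechet_derivative f (at p)"
  have D: "(f has_derivative ?D) (at p)"
    using assms(1) by (simp add: frechet_derivative_works)
  have "(S has_derivative S) (at p)"
    using assms(2) by (rule bounded_linear_imp_has_derivative)
  then have "(f \<circ> S has_derivative ?D \<circ> S) (at p)"
    by (rule diff_chain_at) (simp add: fixed D)
  moreover have "((\<lambda>x. P (f x)) has_derivative (\<lambda>x. P (?D x))) (at p)"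
    using assms(3) D by (rule bounded_linear.has_derivative)
  then have "(f \<circ> S has_derivative (\<lambda>x. P (?D x))) (at p)"
    by (simp add: o_def equivariant)
  ultimately have "?D \<circ> S = (\<lambda>x. P (?D x))"
    by (rule has_derivative_unique)
  then show ?thesis by (simp add: fun_eq_iff)
qed

lemma Z2_hom_minus_one_involution:
  assumes "h \<in> hom Z2 G" and "group G"
  shows "h (-1) \<otimes>\<^bsub>G\<^esub> h (-1) = \<one>\<^bsub>G\<^esub>"
  using hom_mult[OF assms(1), of "-1" "-1"] hom_one[OF assms(1) group_Z2 assms(2)]
  by (simp add: Z2_def)

definition twist :: "('v \<Rightarrow> 'v) \<Rightarrow> ('x \<Rightarrow> 'x) \<Rightarrow> 'x ^ 'v::finite \<Rightarrow> 'x ^ 'v" where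
  "twist s T x = (\<chi> v. T (x $ s v))"

text \<open>
  Continuity comes from \<open>twist s T\<close> being an isometry for the norm of \<open>X\<^sup>V\<close>, whose square is
  \<open>\<Sum>v. (norm (x $ v))\<^sup>2\<close>.
\<close>

lemma bounded_linear_twist:
  fixes T :: "'x::real_normed_vector \<Rightarrow> 'x" and s :: "'v::finite \<Rightarrow> 'v"
  assumes "linear T" and "\<And>x. norm (T x) = norm x" and "bij s"
  shows "bounded_linear (twist s T)"
proof (rule bounded_linear_intro)
  fix x :: "'x ^ 'v"
  have "(\<Sum>v\<in>UNIV. (norm (x $ s v))\<^sup>2) = (\<Sum>v\<in>UNIV. (norm (x $ v))\<^sup>2)"
    using assms(3) by (rule sum.reindex_bij_betw)
  then show "norm (twist s T x) \<le> norm x * 1"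
    by (simp add: twist_def norm_vec_def L2_set_def assms(2))
qed (simp_all add: twist_def vec_eq_iff linear_add[OF assms(1)] linear_scale[OF assms(1)])

definition edge_swap :: "('v::finite \<Rightarrow> 'v) \<Rightarrow> real ^ 'v set \<Rightarrow> real ^ 'v set" where
  "edge_swap s y = (\<chi> e. y $ (s ` e))"

lemma bounded_linear_edge_swap: "bounded_linear (edge_swap s)"
  by (simp flip: linear_conv_bounded_linear)
    (rule linearI, simp_all add: edge_swap_def vec_eq_iff)

definition edge_projection :: "'v::finite set set \<Rightarrow> real ^ 'v set \<Rightarrow> real ^ 'v set" where
  "edge_projection E y = (\<chi> e. if e \<in> E then y $ e else 0)"

lemma bounded_linear_edge_projection: "bounded_linear (edge_projection E)"
  by (simp flip: linear_conv_bounded_linear)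
    (rule linearI, simp_all add: edge_projection_def vec_eq_iff)

lemma edge_space_iff: "y \<in> edge_space E \<longleftrightarrow> edge_projection E y = y"
  by (auto simp: edge_space_def edge_projection_def vec_eq_iff)

text \<open>
  Taking the identity and the projection onto the edge space as the intertwined pair turns the
  inclusion of the range of the rigidity map into one for its differential.
\<close>

lemma rigidity_differential_in_edge_space:
  assumes "well_positioned E p"
  shows "rigidity_differential E p x \<in> edge_space E"
proof -
  have "rigidity_map E y = edge_projection E (rigidity_map E y)" for y
    using rigidity_map_in_edge_space[of E y] by (simp add: edge_space_iff)
  then have "rigidity_differential E p x = edge_projection E (rigidity_differential E p x)"
    unfolding rigidity_differential_def
    using assms[unfolded well_positioned_def] bounded_linear_ident bounded_linear_edge_projection
    by (intro derivative_at_fixed_point_intertwines) auto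
  then show ?thesis by (simp add: edge_space_iff)
qed

text \<open>
  An automorphism is defined by its effect on sets \<open>{v, w}\<close>, so an arbitrary vertex set has to be
  recognised as such a pair first: a bijection preserves cardinality, and edges have two elements.
\<close>

lemma image_edge_iff:
  assumes "simple_graph E" and "\<pi> \<in> carrier (Aut E)"
  shows "\<pi> ` e \<in> E \<longleftrightarrow> e \<in> E"
proof -
  have "bij \<pi>"
    using assms(2) by (simp add: Aut_def)
  then have "card (\<pi> ` e) = card e"
    by (meson bij_is_inj card_image inj_on_subset subset_UNIV)
  then have "card e = 2" if "\<pi> ` e \<in> E \<or> e \<in> E"
    using that assms(1) by (auto simp: simple_graph_def)
  moreover have "{\<pi> v, \<pi> w} \<in> E \<longleftrightarrow> {v, w} \<in> E" for v w
    using assms(2) by (simp add: Aut_def)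
  then have "\<pi> ` e \<in> E \<longleftrightarrow> e \<in> E" if "card e = 2"
    using that unfolding card_2_iff by (metis image_empty image_insert)
  ultimately show ?thesis by blast
qed

lemma rigidity_map_twist:
  assumes "simple_graph E" and "s \<in> carrier (Aut E)"
    and "linear T" and "\<And>x. norm (T x) = norm x"
  shows "rigidity_map E (twist s T x) = edge_swap s (rigidity_map E x)"
proof -
  have "edge_length (twist s T x) e = edge_length x (s ` e)" if "e \<in> E" for e
  proof -
    have "card e = 2"
      using assms(1) that by (simp add: simple_graph_def)
    then obtain v w where "e = {v, w}"
      by (meson card_2_iff)
    then show ?thesis
      by (simp add: edge_length_pair twist_def assms(4) flip: linear_diff[OF assms(3)])
  qed
  then show ?thesis
    by (simp add: rigidity_map_def edge_swap_def vec_eq_iff image_edge_iff[OF assms(1,2)])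
qed

theorem lemma1:
  fixes E :: "'v::finite set set"
    and p :: "'x::real_normed_vector ^ 'v"
    and \<theta> :: "int \<Rightarrow> 'v \<Rightarrow> 'v"
    and \<tau> :: "int \<Rightarrow> 'x \<Rightarrow> 'x"
  assumes finite_dim: "\<exists>B. finite_dimensional_vector_space ((*\<^sub>R) :: real \<Rightarrow> 'x \<Rightarrow> 'x) B"
    and framework: "bar_joint_framework E p"
    and well_positioned: "well_positioned E p"
    and action: "\<theta> \<in> hom Z2 (Aut E)"
    and free: "free_action \<theta>"
    and rep: "\<tau> \<in> hom Z2 Isom"
    and symmetric: "Z2_symmetric \<theta> \<tau> p"
  shows "is_direct_sum UNIV (X1 \<theta> \<tau>) (X2 \<theta> \<tau>)
    \<and> is_direct_sum (edge_space E) (Y1 E \<theta>) (Y2 E \<theta>)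
    \<and> (\<exists>R1 R2. linear_between (X1 \<theta> \<tau>) (Y1 E \<theta>) R1
          \<and> linear_between (X2 \<theta> \<tau>) (Y2 E \<theta>) R2
          \<and> is_direct_sum_map (X1 \<theta> \<tau>) (X2 \<theta> \<tau>) (rigidity_differential E p) R1 R2)"
proof -
  let ?s = "\<theta> (-1)" and ?T = "\<tau> (-1)" and ?D = "rigidity_differential E p"
  let ?S = "twist ?s ?T" and ?P = "edge_swap ?s"
  have simple: "simple_graph E"
    using framework by (simp add: bar_joint_framework_def)
  have s: "?s \<in> carrier (Aut E)" and T: "?T \<in> carrier Isom"
    using hom_in_carrier[OF action, of "-1"] hom_in_carrier[OF rep, of "-1"]
    by (simp_all add: Z2_def)
  have "bij ?s" and T': "linear ?T" "\<And>x. norm (?T x) = norm x"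
    using s T by (simp_all add: Aut_def Isom_def)
  have ss: "?s (?s v) = v" and TT: "?T (?T x) = x" for v x
    using Z2_hom_minus_one_involution[OF action group_Aut]
      Z2_hom_minus_one_involution[OF rep group_Isom]
    by (simp_all add: Aut_def Isom_def fun_eq_iff)
  have S: "bounded_linear ?S"
    using T' \<open>bij ?s\<close> by (rule bounded_linear_twist)
  have edge: "?s ` e \<in> E \<longleftrightarrow> e \<in> E" for e
    using simple s by (rule image_edge_iff)
  have W: "subspace (edge_space E)"
    by (auto simp: subspace_def edge_space_def)

  have TN: "?T (- x) = - ?T x" for x
    using T'(1) by (rule linear_neg)
  have T_eq: "?T x = y \<longleftrightarrow> x = ?T y" for x y
    using TT by metis
  have X1: "X1 \<theta> \<tau> = {x \<in> UNIV. ?S x = x}"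
    unfolding X1_def twist_def vec_eq_iff by (simp add: T_eq)
  have X2: "X2 \<theta> \<tau> = {x \<in> UNIV. ?S x = - x}"
    unfolding X2_def twist_def vec_eq_iff by (simp add: T_eq TN)
  \<comment> \<open>\<open>Y1\<close> and \<open>Y2\<close> constrain only the coordinates in \<open>E\<close>; on the edge space the others read \<open>0 = 0\<close>.\<close>
  have off: "y $ (?s ` e) = 0" "y $ e = 0" if "y \<in> edge_space E" "e \<notin> E" for y e
    using that by (auto simp: edge_space_def edge)
  have Y1: "Y1 E \<theta> = {y \<in> edge_space E. ?P y = y}"
    unfolding Y1_def edge_swap_def vec_eq_iff
    by (intro Collect_cong conj_cong refl) (simp, metis off)
  have Y2: "Y2 E \<theta> = {y \<in> edge_space E. ?P y = - y}"
    unfolding Y2_def edge_swap_def vec_eq_iff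
    by (intro Collect_cong conj_cong refl) (simp, metis off minus_zero)

  have X: "is_direct_sum UNIV (X1 \<theta> \<tau>) (X2 \<theta> \<tau>)"
    unfolding X1 X2 using bounded_linear.linear[OF S]
    by (rule involution_eigenspaces_direct_sum) (simp_all add: twist_def ss TT)
  have Y: "is_direct_sum (edge_space E) (Y1 E \<theta>) (Y2 E \<theta>)"
    unfolding Y1 Y2 using bounded_linear.linear[OF bounded_linear_edge_swap] W
    by (rule involution_eigenspaces_direct_sum)
      (simp_all add: edge_swap_def edge_space_def edge ss image_image)

  have "?S p = p"
    using symmetric by (simp add: Z2_symmetric_def twist_def vec_eq_iff ss)
  then have DS: "?D (?S x) = ?P (?D x)" for x
    unfolding rigidity_differential_def
    using well_positioned[unfolded well_positioned_def] S bounded_linear_edge_swap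
      rigidity_map_twist[OF simple s T']
    by (intro derivative_at_fixed_point_intertwines)
  have D: "linear ?D"
    using well_positioned unfolding well_positioned_def rigidity_differential_def
    by (rule linear_frechet_derivative)
  note D_simps = linear_add[OF D] linear_scale[OF D] linear_neg[OF D]
  have range: "?D x \<in> edge_space E" for x
    using well_positioned by (rule rigidity_differential_in_edge_space)
  have "linear_between (X1 \<theta> \<tau>) (Y1 E \<theta>) ?D"
    unfolding linear_between_def X1 Y1 by (auto simp: D_simps range simp flip: DS)
  moreover have "linear_between (X2 \<theta> \<tau>) (Y2 E \<theta>) ?D"
    unfolding linear_between_def X2 Y2 by (auto simp: D_simps range simp flip: DS)
  moreover have "is_direct_sum_map (X1 \<theta> \<tau>) (X2 \<theta> \<tau>) ?D ?D ?D"
    by (simp add: is_direct_sum_map_def D_simps)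
  ultimately show ?thesis using X Y by blast
qed

end
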